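(* Let $n,k,d$ be integers with $n>d\geq 0$ and $k\geq 2$. If $G$ is an $(n,k,d)$-graph, then $G$ is also an $(n+2,k-2,d)$-graph.
   Context: All graphs are finite, undirected and simple. A $k$-matching is a matching with exactly $k$ edges. For a non-negative integer $d$, a defect-$d$ matching of a graph $H$ is a matching covering exactly $|V(H)|-d$ vertices of $H$. A matching $M$ extends to a matching $M'$ if $M\subseteq M'$. Let $n,k,d$ be non-negative integers. A graph $G$ is an $(n,k,d)$-graph if $|V(G)|\geq n+2k+d+2$, $|V(G)|-n-d$ is even, and for every set $S$ of $n$ vertices of $G$, the graph $H=G-S$ contains a $k$-matching and every $k$-matching of $H$ can be extended to a defect-$d$ matching of $H$. *)

theory Defs
  imports Main
begin

record 'a graph =
  verts :: "'a set"
  edges :: "'a set set"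

definition finite_simple_graph :: "'a graph \<Rightarrow> bool" where
  "finite_simple_graph G \<longleftrightarrow>
     finite (verts G) \<and> (\<forall>e\<in>edges G. e \<subseteq> verts G \<and> card e = 2)"

definition delete_verts :: "'a graph \<Rightarrow> 'a set \<Rightarrow> 'a graph" where
  "delete_verts G S =
     \<lparr>verts = verts G - S, edges = {e \<in> edges G. e \<inter> S = {}}\<rparr>"

definition matching :: "'a graph \<Rightarrow> 'a set set \<Rightarrow> bool" where
  "matching G M \<longleftrightarrow> M \<subseteq> edges G \<and> pairwise disjnt M"

definition k_matching :: "nat \<Rightarrow> 'a graph \<Rightarrow> 'a set set \<Rightarrow> bool" where
  "k_matching k G M \<longleftrightarrow> matching G M \<and> finite M \<and> card M = k"

text \<open>The covered vertices are \<open>\<Union>M\<close>. Their number is fixed by an additive equation,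
  because subtraction on natural numbers truncates.\<close>

definition defect_matching :: "nat \<Rightarrow> 'a graph \<Rightarrow> 'a set set \<Rightarrow> bool" where
  "defect_matching d G M \<longleftrightarrow> matching G M \<and> card (\<Union>M) + d = card (verts G)"

definition nkd_graph :: "nat \<Rightarrow> nat \<Rightarrow> nat \<Rightarrow> 'a graph \<Rightarrow> bool" where
  "nkd_graph n k d G \<longleftrightarrow>
     finite_simple_graph G \<and>
     card (verts G) \<ge> n + 2 * k + d + 2 \<and>
     even (int (card (verts G)) - int n - int d) \<and>
     (\<forall>S. S \<subseteq> verts G \<and> card S = n \<longrightarrow>
        (\<exists>M. k_matching k (delete_verts G S) M) \<and>
        (\<forall>M. k_matching k (delete_verts G S) M \<longrightarrow>
           (\<exists>M'. M \<subseteq> M' \<and> defect_matching d (delete_verts G S) M')))"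

end

theory Submission
  imports Defs
begin

text \<open>If a \<open>(k-2)\<close>-matching \<open>M\<close> avoiding an \<open>(n+2)\<close>-set \<open>S\<close> does not extend, the Berge-Tutte formula
  for \<open>G - S - V(M)\<close> yields a set \<open>T\<close> leaving \<open>|T| + d + 2\<close> odd parts. Put \<open>W = S \<union> T\<close>. Adding to \<open>M\<close> one
  or two edges at \<open>W\<close> gives a \<open>(k-1)\<close>- or \<open>k\<close>-matching, which must extend (an \<open>(n,k,d)\<close>-graph is also an
  \<open>(n,k-1,d)\<close>-graph). Counting odd parts then shows that \<open>W\<close> is independent, has no neighbours in the
  even remainder, and never has two disjoint edges into one odd part. So the edges from \<open>W\<close> to an odd
  part form a star. Deleting the star centres isolates the rest of \<open>W\<close>, which leaves too
  many odd parts because \<open>d < n\<close>.\<close>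

section \<open>Matchings\<close>

lemma finite_edge:
  assumes "finite_simple_graph G" "e \<in> edges G"
  shows "finite e" "e \<subseteq> verts G" "card e = 2" "e \<noteq> {}"
  using assms unfolding finite_simple_graph_def
  by (auto intro: finite_subset)

lemma edge_other_end:
  assumes "finite_simple_graph G" "e \<in> edges G" "x \<in> e"
  obtains y where "e = {x, y}" "x \<noteq> y"
proof -
  obtain a b where "e = {a, b}" "a \<noteq> b"
    using finite_edge(3)[OF assms(1,2)] by (auto simp: card_2_iff)
  then show ?thesis using assms(3) that[of b] that[of a] by (auto simp: insert_commute)
qed

lemma finite_edges:
  assumes "finite_simple_graph G"
  shows "finite (edges G)"
  using assms unfolding finite_simple_graph_def
  by (meson PowI finite_Pow_iff finite_subset subsetI)

lemma finite_matching:
  assumes "finite_simple_graph G" "matching G F"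
  shows "finite F"
  using finite_subset[OF _ finite_edges[OF assms(1)]] assms(2) unfolding matching_def by simp

lemma matching_verts:
  assumes "finite_simple_graph G" "matching G F"
  shows "\<Union>F \<subseteq> verts G" "finite (\<Union>F)"
proof -
  show "\<Union>F \<subseteq> verts G" using assms finite_edge(2) unfolding matching_def by blast
  then show "finite (\<Union>F)" using assms(1) unfolding finite_simple_graph_def
    by (auto intro: finite_subset)
qed

lemma matching_unique:
  assumes "matching G F" "e \<in> F" "f \<in> F" "x \<in> e" "x \<in> f"
  shows "e = f"
  using assms unfolding matching_def pairwise_def disjnt_def by blast

lemma matching_subset:
  assumes "matching G F" "F' \<subseteq> F"
  shows "matching G F'"
  using assms unfolding matching_def pairwise_def by blast

lemma matching_insert:
  assumes "matching G F" "e \<in> edges G" "e \<inter> \<Union>F = {}"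
  shows "matching G (insert e F)"
  using assms unfolding matching_def pairwise_def disjnt_def by blast

lemma card_Union_matching:
  assumes "finite_simple_graph G" "matching G F"
  shows "card (\<Union>F) = 2 * card F"
proof -
  have "card (\<Union>F) = sum card F"
    using assms finite_edge(1) unfolding matching_def
    by (intro card_Union_disjoint) blast+
  also have "\<dots> = (\<Sum>e\<in>F. 2)"
    using assms finite_edge(3) unfolding matching_def by (intro sum.cong) blast+
  finally show ?thesis by simp
qed

text \<open>Under these hypotheses \<open>D\<close> is the union of the matching edges inside it.
  Contrapositively, an odd set has a vertex that is missed or matched outwards.\<close>

lemma even_card_saturated:
  assumes "finite_simple_graph G" "matching G F" "D \<subseteq> \<Union>F"
    and closed: "\<And>e. e \<in> F \<Longrightarrow> e \<inter> D \<noteq> {} \<Longrightarrow> e \<subseteq> D"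
  shows "even (card D)"
proof -
  let ?F = "{e \<in> F. e \<subseteq> D}"
  have "D = \<Union>?F" using assms(3) closed by fast
  moreover have "matching G ?F" by (rule matching_subset[OF assms(2)]) auto
  ultimately show ?thesis using card_Union_matching[OF assms(1)] by (metis dvd_triv_left)
qed

lemma finite_simple_delete:
  "finite_simple_graph G \<Longrightarrow> finite_simple_graph (delete_verts G S)"
  unfolding finite_simple_graph_def delete_verts_def by auto

lemma matching_delete_iff:
  "matching (delete_verts G S) F \<longleftrightarrow> matching G F \<and> \<Union>F \<inter> S = {}"
  unfolding matching_def delete_verts_def by auto

lemma k_matching_delete_iff:
  "k_matching k (delete_verts G S) F \<longleftrightarrow> k_matching k G F \<and> \<Union>F \<inter> S = {}"
  unfolding k_matching_def matching_delete_iff by auto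

lemma k_matching_insert:
  assumes "k_matching k G F" "e \<in> edges G" "e \<inter> \<Union>F = {}" "e \<noteq> {}"
  shows "k_matching (Suc k) G (insert e F)"
proof -
  have "e \<notin> F" using assms(3,4) by blast
  then show ?thesis using assms(1) matching_insert[OF _ assms(2,3)] unfolding k_matching_def by simp
qed

section \<open>The Berge-Tutte formula\<close>

text \<open>The members of \<open>C\<close> play the role of odd components of \<open>G - T\<close>. Connectedness is not
  required, and the vertices outside \<open>T \<union> \<Union>C\<close> are joined to no member of \<open>C\<close>.\<close>

definition odd_family :: "'a graph \<Rightarrow> 'a set \<Rightarrow> 'a set set \<Rightarrow> bool" where
  "odd_family G T C \<longleftrightarrow> C \<subseteq> Pow (verts G - T) \<and> pairwise disjnt C \<and>
     (\<forall>D\<in>C. odd (card D)) \<and>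
     (\<forall>e\<in>edges G. \<forall>D\<in>C. e \<inter> T = {} \<longrightarrow> e \<inter> D \<noteq> {} \<longrightarrow> e \<subseteq> D)"

lemma odd_family_subset:
  assumes "odd_family G T C" "C' \<subseteq> C"
  shows "odd_family G T C'"
proof -
  have "pairwise disjnt C'"
    using assms pairwise_subset[of disjnt C C'] unfolding odd_family_def by simp
  moreover have "\<And>D. D \<in> C' \<Longrightarrow> D \<in> C" using assms(2) by blast
  ultimately show ?thesis using assms(1) unfolding odd_family_def by auto
qed

lemma odd_family_disjoint:
  assumes "odd_family G T C" "D \<in> C" "D' \<in> C" "x \<in> D" "x \<in> D'"
  shows "D = D'"
proof (rule ccontr)
  assume "D \<noteq> D'"
  then have "D \<inter> D' = {}"
    using assms(1-3) unfolding odd_family_def pairwise_def disjnt_def by simp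
  then show False using assms(4,5) by blast
qed

lemma odd_familyD:
  assumes "odd_family G T C" "D \<in> C"
  shows "D \<subseteq> verts G" "D \<inter> T = {}" "odd (card D)" "D \<noteq> {}"
    and "e \<in> edges G \<Longrightarrow> e \<inter> T = {} \<Longrightarrow> x \<in> e \<Longrightarrow> x \<in> D \<Longrightarrow> e \<subseteq> D"
proof -
  show "e \<subseteq> D" if "e \<in> edges G" "e \<inter> T = {}" "x \<in> e" "x \<in> D"
  proof -
    have "e \<inter> D \<noteq> {}" using that by blast
    then show ?thesis using assms that unfolding odd_family_def by simp
  qed
qed (use assms in \<open>auto simp: odd_family_def\<close>)

lemma odd_familyI:
  assumes "\<And>D. D \<in> C \<Longrightarrow> D \<subseteq> verts G" "\<And>D. D \<in> C \<Longrightarrow> D \<inter> T = {}"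
    "\<And>D. D \<in> C \<Longrightarrow> odd (card D)"
    "\<And>D D' x. D \<in> C \<Longrightarrow> D' \<in> C \<Longrightarrow> x \<in> D \<Longrightarrow> x \<in> D' \<Longrightarrow> D = D'"
    "\<And>D e x. D \<in> C \<Longrightarrow> e \<in> edges G \<Longrightarrow> e \<inter> T = {} \<Longrightarrow> x \<in> e \<Longrightarrow> x \<in> D \<Longrightarrow> e \<subseteq> D"
  shows "odd_family G T C"
  unfolding odd_family_def
proof (intro conjI ballI impI)
  show "C \<subseteq> Pow (verts G - T)" using assms(1,2) by blast
  show "pairwise disjnt C" using assms(4) unfolding pairwise_def disjnt_def by blast
  show "e \<subseteq> D" if "e \<in> edges G" "D \<in> C" "e \<inter> T = {}" "e \<inter> D \<noteq> {}" for e D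
    using assms(5)[OF that(2,1,3)] that(4) by blast
qed (use assms(3) in blast)

lemma finite_odd_family:
  "finite_simple_graph G \<Longrightarrow> odd_family G T C \<Longrightarrow> finite C"
  unfolding finite_simple_graph_def odd_family_def
  using finite_subset[of C "Pow (verts G - T)"] by simp

text \<open>This is the easy half of Berge-Tutte. Each odd part contains a missed vertex or sends a
  matching edge to \<open>T\<close>, and these witnesses are distinct. The additive form avoids
  truncated subtraction.\<close>

lemma odd_family_bound:
  assumes G: "finite_simple_graph G" and F: "matching G F"
    and T: "T \<subseteq> verts G" and C: "odd_family G T C"
  shows "card C + card (\<Union>F) \<le> card T + card (verts G)"
proof -
  \<comment> \<open>The witness \<open>x\<close> for \<open>D\<close> is a missed vertex of
    \<open>D\<close> itself or the end in \<open>T\<close> of a matching edge leaving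
    \<open>D\<close>.\<close>
  define P where "P D x \<longleftrightarrow> x \<in> D \<and> x \<notin> \<Union>F \<or> x \<in> T \<and> (\<exists>c\<in>D. {x, c} \<in> F)" for D x
  have "\<exists>x. P D x" if D: "D \<in> C" for D
  proof (rule ccontr)
    assume no: "\<nexists>x. P D x"
    have "e \<subseteq> D" if e: "e \<in> F" "e \<inter> D \<noteq> {}" for e
    proof -
      obtain c where c: "c \<in> e" "c \<in> D" using e by blast
      have eG: "e \<in> edges G" using e F unfolding matching_def by blast
      obtain t where t: "e = {c, t}" using edge_other_end[OF G eG c(1)] by metis
      have "c \<notin> T" using C D c unfolding odd_family_def by blast
      moreover have "t \<notin> T" using no e c t unfolding P_def by (metis insert_commute)
      ultimately have "e \<inter> T = {}" using t by blast
      then show ?thesis using C D eG e unfolding odd_family_def by blast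
    qed
    moreover have "D \<subseteq> \<Union>F" using no unfolding P_def by blast
    ultimately have "even (card D)" using even_card_saturated[OF G F] by blast
    then show False using C D unfolding odd_family_def by blast
  qed
  then obtain p where p: "\<And>D. D \<in> C \<Longrightarrow> P D (p D)" by metis
  have sub: "p D \<in> T \<union> (verts G - \<Union>F)" if "D \<in> C" for D
    using p[OF that] that C unfolding P_def odd_family_def by blast
  have "inj_on p C"
  proof (rule inj_onI)
    fix D D' assume D: "D \<in> C" "D' \<in> C" "p D = p D'"
    have disjT: "D \<inter> T = {}" "D' \<inter> T = {}" using D C unfolding odd_family_def by blast+
    note pp = p[OF D(1)] p[OF D(2)]
    show "D = D'"
    proof (cases "p D \<in> T")
      case True
      then obtain c c' where cc: "c \<in> D" "{p D, c} \<in> F" "c' \<in> D'" "{p D, c'} \<in> F"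
        using pp D(3) disjT unfolding P_def by auto
      \<comment> \<open>A witness in \<open>T\<close> determines its matching edge, hence the end of
        that edge in the part.\<close>
      have "{p D, c} = {p D, c'}" using matching_unique[OF F cc(2,4)] by blast
      moreover have "c \<noteq> p D" "c' \<noteq> p D" using True cc disjT by blast+
      ultimately have "c = c'" by (simp add: doubleton_eq_iff)
      then show ?thesis using odd_family_disjoint[OF C D(1,2)] cc by blast
    next
      case False
      then have "p D \<in> D" "p D \<in> D'" using pp D(3) unfolding P_def by auto
      then show ?thesis using odd_family_disjoint[OF C D(1,2)] by blast
    qed
  qed
  have finV: "finite (verts G)" using G unfolding finite_simple_graph_def by blast
  have "card C \<le> card (T \<union> (verts G - \<Union>F))"
    using \<open>inj_on p C\<close> sub finV T
    by (intro card_inj_on_le[of p]) (auto intro: finite_subset)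
  also have "\<dots> \<le> card T + (card (verts G) - card (\<Union>F))"
    using card_Un_le[of T "verts G - \<Union>F"] card_Diff_subset[OF matching_verts(2,1)[OF G F]]
    by simp
  finally show ?thesis using card_mono[OF finV matching_verts(1)[OF G F]] by linarith
qed

section \<open>Maximum matchings and Gallai's exchange argument\<close>

definition max_matching :: "'a graph \<Rightarrow> 'a set set \<Rightarrow> bool" where
  "max_matching G F \<longleftrightarrow> matching G F \<and> (\<forall>F'. matching G F' \<longrightarrow> card F' \<le> card F)"

lemma ex_max_matching:
  assumes "finite_simple_graph G"
  obtains F where "max_matching G F"
proof -
  have "matching G {}" unfolding matching_def by simp
  moreover have "\<forall>F. matching G F \<longrightarrow> card F \<le> card (edges G)"
    using finite_edges[OF assms] card_mono unfolding matching_def by blast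
  ultimately obtain F where "matching G F" "\<forall>F'. matching G F' \<longrightarrow> card F' \<le> card F"
    using ex_has_greatest_nat[of "matching G" "{}" card "Suc (card (edges G))"]
    by (metis le_imp_less_Suc)
  then show ?thesis using that unfolding max_matching_def by blast
qed

lemma max_matching_covers:
  assumes "finite_simple_graph G" "max_matching G F" "e \<in> edges G"
  shows "e \<inter> \<Union>F \<noteq> {}"
proof
  assume e: "e \<inter> \<Union>F = {}"
  have F: "matching G F" using assms(2) unfolding max_matching_def by blast
  have "e \<notin> F" using e finite_edge(4)[OF assms(1,3)] by blast
  then have "card (insert e F) = Suc (card F)" using finite_matching[OF assms(1) F] by simp
  then show False using matching_insert[OF F assms(3) e] assms(2)
    unfolding max_matching_def by (metis Suc_n_not_le_n)
qed

text \<open>Transitivity of ``no maximum matching misses both'': a maximum matching \<open>N'\<close> missing \<open>v\<close>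
  can be moved towards \<open>N\<close> by exchanging one edge, until a counting contradiction arises.\<close>

lemma gallai_transitive:
  assumes G: "finite_simple_graph G"
    and N: "max_matching G N" "u \<notin> \<Union>N" "w \<notin> \<Union>N" "u \<noteq> w"
    and N': "max_matching G N'" "v \<notin> \<Union>N'"
  shows "\<exists>F. max_matching G F \<and> v \<notin> \<Union>F \<and> (u \<notin> \<Union>F \<or> w \<notin> \<Union>F)"
proof (rule ccontr)
  assume no: "\<not> ?thesis"
  have mN: "matching G N" using N(1) unfolding max_matching_def by blast
  show False using N'
  proof (induction "card (N - N')" arbitrary: N' rule: less_induct)
    case less
    have mN': "matching G N'" using less.prems unfolding max_matching_def by blast
    have "card N = card N'" using N(1) less.prems(1) unfolding max_matching_def
      by (meson le_antisym)
    then have eq: "card (\<Union>N) = card (\<Union>N')"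
      using card_Union_matching[OF G] mN mN' by simp
    have uw: "u \<in> \<Union>N'" "w \<in> \<Union>N'" using no less.prems by blast+
    have fin: "finite (\<Union>N)" "finite (\<Union>N')" using matching_verts(2)[OF G] mN mN' by blast+
    \<comment> \<open>\<open>N'\<close> covers \<open>u\<close> and \<open>w\<close>, which
      \<open>N\<close> misses. As both cover equally many vertices, \<open>N\<close> covers at least
      two vertices missed by \<open>N'\<close>, one of them different from \<open>v\<close>.\<close>
    have "2 = card {u, w}" using N(4) by simp
    also have "\<dots> \<le> card (\<Union>N' - \<Union>N)" using uw N(2,3) fin by (intro card_mono) auto
    also have "\<dots> = card (\<Union>N - \<Union>N')" using eq fin
      by (metis card_Diff_subset_Int Int_commute finite_Int)
    finally have "\<not> \<Union>N - \<Union>N' \<subseteq> {v}" using card_mono[of "{v}" "\<Union>N - \<Union>N'"] by auto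
    then obtain x e where x: "x \<notin> \<Union>N'" "x \<noteq> v" "x \<in> e" "e \<in> N" by blast
    have eG: "e \<in> edges G" using x mN unfolding matching_def by blast
    obtain y where y: "e = {x, y}" using edge_other_end[OF G eG x(3)] by metis
    have "y \<in> \<Union>N'" using max_matching_covers[OF G less.prems(1) eG] x(1) y by blast
    then obtain f where f: "f \<in> N'" "y \<in> f" by blast
    define N2 where "N2 = insert e (N' - {f})"
    have "e \<inter> \<Union>(N' - {f}) = {}"
      using x(1) y f matching_unique[OF mN' f(1) _ f(2)] by blast
    then have m2: "matching G N2" unfolding N2_def
      by (rule matching_insert[OF matching_subset[OF mN' Diff_subset] eG])
    have "e \<notin> N'" using x by blast
    then have "card N2 = card N'" unfolding N2_def
      using f(1) card_Suc_Diff1[OF finite_matching[OF G mN'] f(1)] finite_matching[OF G mN']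
      by (simp del: card_Diff_insert)
    then have max2: "max_matching G N2" using m2 less.prems(1) unfolding max_matching_def by simp
    have v2: "v \<notin> \<Union>N2" unfolding N2_def using less.prems(2) x y \<open>y \<in> \<Union>N'\<close> by blast
    \<comment> \<open>The edge of \<open>N\<close> at \<open>y\<close> is \<open>e\<close>, so
      exchanging \<open>f\<close> for \<open>e\<close> brings \<open>N'\<close> strictly closer to
      \<open>N\<close>.\<close>
    have "f \<notin> N" using matching_unique[OF mN x(4) _ _ f(2)] y x f(1) by blast
    then have "N - N2 \<subset> N - N'" unfolding N2_def using x(4) \<open>e \<notin> N'\<close> by blast
    then have "card (N - N2) < card (N - N')"
      using finite_matching[OF G mN] by (meson finite_Diff psubset_card_mono)
    from less.hyps[OF this max2 v2] show False .
  qed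
qed

text \<open>"Never missed together by a maximum matching" is an equivalence whose classes are closed
  under adjacency. A maximum matching misses at most one vertex of each class, and a class with a
  missed vertex is odd. So the odd classes, with empty deleted set, account for all missed
  vertices.\<close>

lemma berge_all_inessential:
  assumes G: "finite_simple_graph G"
    and miss: "\<And>v. v \<in> verts G \<Longrightarrow> \<exists>F. max_matching G F \<and> v \<notin> \<Union>F"
  shows "\<exists>F C. matching G F \<and> odd_family G {} C \<and> card (verts G) \<le> card (\<Union>F) + card C"
proof -
  let ?V = "verts G"
  have finV: "finite ?V" using G unfolding finite_simple_graph_def by blast
  \<comment> \<open>Equality is a separate clause: by \<open>miss\<close>, the second clause fails
    for every pair of equal vertices.\<close>
  define r where "r = {(u, v). u \<in> ?V \<and> v \<in> ?V \<and>
    (u = v \<or> (\<forall>F. max_matching G F \<longrightarrow> u \<in> \<Union>F \<or> v \<in> \<Union>F))}"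
  have rD: "u \<in> ?V" "v \<in> ?V" "u \<noteq> v \<Longrightarrow> max_matching G F \<Longrightarrow> u \<in> \<Union>F \<or> v \<in> \<Union>F"
    if "(u, v) \<in> r" for u v F
    using that unfolding r_def by auto
  have rI: "(u, v) \<in> r" if "u \<in> ?V" "v \<in> ?V"
      "\<And>F. u \<noteq> v \<Longrightarrow> max_matching G F \<Longrightarrow> u \<notin> \<Union>F \<Longrightarrow> v \<notin> \<Union>F \<Longrightarrow> False" for u v
    using that unfolding r_def by auto
  have "trans r"
  proof (rule transI)
    fix u v w assume a: "(u, v) \<in> r" "(v, w) \<in> r"
    show "(u, w) \<in> r"
    proof (rule rI)
      show "u \<in> ?V" "w \<in> ?V" using rD(1)[OF a(1)] rD(2)[OF a(2)] .
      fix N assume N: "u \<noteq> w" "max_matching G N" "u \<notin> \<Union>N" "w \<notin> \<Union>N"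
      obtain N' where N': "max_matching G N'" "v \<notin> \<Union>N'"
        using miss[OF rD(2)[OF a(1)]] by metis
      obtain F where F: "max_matching G F" "v \<notin> \<Union>F" "u \<notin> \<Union>F \<or> w \<notin> \<Union>F"
        using gallai_transitive[OF G N(2-4,1) N'] by metis
      have "u \<noteq> v" "v \<noteq> w" using rD(3)[OF a(2) _ N(2)] rD(3)[OF a(1) _ N(2)] N by metis+
      then show False using rD(3)[OF a(1) _ F(1)] rD(3)[OF a(2) _ F(1)] F(2,3) by metis
    qed
  qed
  then have eq: "equiv ?V r"
    by (intro equivI) (auto simp: refl_on_def sym_def r_def)
  define C where "C = {D \<in> ?V // r. odd (card D)}"
  have edge: "e \<subseteq> D" if e: "e \<in> edges G" "e \<inter> D \<noteq> {}" and D: "D \<in> ?V // r" for e D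
  proof -
    obtain a where a: "a \<in> e" "a \<in> D" using e by blast
    obtain b where b: "e = {a, b}" using edge_other_end[OF G e(1) a(1)] by metis
    have "(a, b) \<in> r" using max_matching_covers[OF G _ e(1)] finite_edge(2)[OF G e(1)] b
      by (intro rI) auto
    then have "b \<in> D" using in_quotient_imp_closed[OF eq D a(2)] by blast
    then show ?thesis using a b by blast
  qed
  have fam: "odd_family G {} C"
    unfolding odd_family_def
  proof (intro conjI ballI impI)
    show "C \<subseteq> Pow (?V - {})" unfolding C_def using in_quotient_imp_subset[OF eq] by blast
    show "pairwise disjnt C"
      using quotient_disj[OF eq] unfolding pairwise_def disjnt_def C_def by blast
      show "odd (card D)" if "D \<in> C" for D using that unfolding C_def by simp
    show "e \<subseteq> D" if "e \<in> edges G" "D \<in> C" "e \<inter> D \<noteq> {}" for e D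
      using edge[OF that(1,3)] that(2) unfolding C_def by simp
  qed
  obtain N where N: "max_matching G N" using ex_max_matching[OF G] by blast
  have mN: "matching G N" using N unfolding max_matching_def by blast
  \<comment> \<open>\<open>N\<close> covers the rest of the class of \<open>x\<close>, and its edges
    there stay inside. So the class without \<open>x\<close> is even.\<close>
  have cls: "r `` {x} \<in> C" if x: "x \<in> ?V - \<Union>N" for x
  proof -
    let ?D = "r `` {x}"
    have D: "?D \<in> ?V // r" using x by (simp add: quotientI)
    have xD: "x \<in> ?D" using equiv_class_self[OF eq] x by blast
    have "?D - {x} \<subseteq> \<Union>N" using rD(3)[OF _ _ N] x by auto
    moreover have "e \<subseteq> ?D - {x}" if "e \<in> N" "e \<inter> (?D - {x}) \<noteq> {}" for e
    proof -
      have "e \<in> edges G" using that(1) mN unfolding matching_def by blast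
      moreover have "x \<notin> e" using that(1) x by blast
      ultimately show ?thesis using edge[OF _ _ D] that(2) by blast
    qed
    ultimately have "even (card (?D - {x}))" using even_card_saturated[OF G mN] by blast
    moreover have "finite ?D" using in_quotient_imp_subset[OF eq D] finV finite_subset by blast
    ultimately have "odd (card ?D)" using card_Suc_Diff1[OF _ xD] by (metis even_Suc)
    then show ?thesis using D unfolding C_def by blast
  qed
  have "inj_on (\<lambda>x. r `` {x}) (?V - \<Union>N)"
  proof (rule inj_onI)
    fix x y assume "x \<in> ?V - \<Union>N" "y \<in> ?V - \<Union>N" "r `` {x} = r `` {y}"
    moreover from this have "(x, y) \<in> r" using eq_equiv_class_iff[OF eq] by blast
    ultimately show "x = y" using rD(3)[OF _ _ N] by blast
  qed
  then have "card (?V - \<Union>N) \<le> card C"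
    using cls finite_odd_family[OF G fam] by (intro card_inj_on_le) auto
  then have "card ?V \<le> card (\<Union>N) + card C"
    using card_Diff_subset[OF matching_verts(2,1)[OF G mN]] by linarith
  then show ?thesis using mN fam by blast
qed

text \<open>The hard half, by induction on the number of vertices. A vertex covered by every maximum
  matching is deleted and put into \<open>T\<close>. If there is none, the preceding case
  applies.\<close>

lemma berge_tutte:
  assumes "finite_simple_graph G"
  shows "\<exists>F T C. matching G F \<and> T \<subseteq> verts G \<and> odd_family G T C \<and>
    card T + card (verts G) \<le> card (\<Union>F) + card C"
  using assms
proof (induction "card (verts G)" arbitrary: G rule: less_induct)
  case less
  note G = less.prems
  have finV: "finite (verts G)" using G unfolding finite_simple_graph_def by blast
  show ?case
  proof (cases "\<forall>v\<in>verts G. \<exists>F. max_matching G F \<and> v \<notin> \<Union>F")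
    case True
    then obtain F C where "matching G F" "odd_family G {} C"
      "card (verts G) \<le> card (\<Union>F) + card C"
      using berge_all_inessential[OF G] by metis
    then show ?thesis by (intro exI[of _ F] exI[of _ "{}"] exI[of _ C]) auto
  next
    case False
    then obtain v where v: "v \<in> verts G" "\<And>F. max_matching G F \<Longrightarrow> v \<in> \<Union>F" by blast
    let ?H = "delete_verts G {v}"
    have vH: "verts ?H = verts G - {v}" unfolding delete_verts_def by simp
    have cH: "card (verts G) = Suc (card (verts ?H))"
      unfolding vH using card_Suc_Diff1[OF finV v(1)] by simp
    obtain F T C where H: "matching ?H F" "T \<subseteq> verts ?H" "odd_family ?H T C"
      "card T + card (verts ?H) \<le> card (\<Union>F) + card C"
      using less.hyps[OF _ finite_simple_delete[OF G]] cH by (metis lessI)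
    have F: "matching G F" "v \<notin> \<Union>F" using H(1) unfolding matching_delete_iff by auto
    obtain N where N: "max_matching G N" using ex_max_matching[OF G] by blast
    then have mN: "matching G N" unfolding max_matching_def by blast
    \<comment> \<open>Otherwise \<open>F\<close> would be a maximum matching missing
      \<open>v\<close>. The two extra vertices covered by \<open>N\<close> pay for \<open>v\<close>
      on the left, where it counts both in the deleted set and in \<open>verts G\<close>.\<close>
    have "card F \<noteq> card N" using v(2)[of F] F N unfolding max_matching_def by auto
    then have "card F < card N" using F N unfolding max_matching_def by (metis le_neq_implies_less)
    then have "card (\<Union>F) + 2 \<le> card (\<Union>N)"
      using card_Union_matching[OF G] F mN by simp
    moreover have "v \<notin> T" "finite T" using H(2) vH finV by (auto intro: finite_subset)
    ultimately have "card (insert v T) + card (verts G) \<le> card (\<Union>N) + card C"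
      using H(4) cH by simp
    moreover have "odd_family G (insert v T) C"
      using H(3) unfolding odd_family_def delete_verts_def by auto
    moreover have "insert v T \<subseteq> verts G" using v(1) H(2) vH by blast
    ultimately show ?thesis using mN by blast
  qed
qed

section \<open>Matching extension\<close>

lemma nkd_graphD:
  assumes "nkd_graph n k d G"
  shows "finite_simple_graph G" "n + 2 * k + d + 2 \<le> card (verts G)"
    "even (int (card (verts G)) - int n - int d)"
  using assms unfolding nkd_graph_def by simp_all

lemma nkd_graph_delete:
  assumes "nkd_graph n k d G" "S \<subseteq> verts G" "card S = n"
  shows "\<exists>M. k_matching k (delete_verts G S) M"
    and "k_matching k (delete_verts G S) M \<Longrightarrow>
      \<exists>F. M \<subseteq> F \<and> defect_matching d (delete_verts G S) F"
  using assms unfolding nkd_graph_def by metis+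

lemma nkd_graph_extend:
  assumes "nkd_graph n k d G" "S \<subseteq> verts G" "card S = n"
    "k_matching k G M" "\<Union>M \<inter> S = {}"
  obtains F where "M \<subseteq> F" "matching G F" "\<Union>F \<inter> S = {}"
    "card (\<Union>F) + d + n = card (verts G)"
proof -
  have G: "finite_simple_graph G" using nkd_graphD(1)[OF assms(1)] .
  obtain F where F: "M \<subseteq> F" "defect_matching d (delete_verts G S) F"
    using nkd_graph_delete(2)[OF assms(1-3)] assms(4,5) unfolding k_matching_delete_iff by metis
  have "finite S" using assms(2) G unfolding finite_simple_graph_def by (auto intro: finite_subset)
  then have "card (verts (delete_verts G S)) = card (verts G) - n"
    unfolding delete_verts_def using assms(2,3) by (simp add: card_Diff_subset)
  moreover have "n \<le> card (verts G)" using nkd_graphD(2)[OF assms(1)] by simp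
  ultimately show ?thesis using F that unfolding defect_matching_def matching_delete_iff by auto
qed

text \<open>Among the \<open>Suc k\<close>-matchings take one, \<open>K\<close>, sharing the most edges with \<open>M\<close>. If its extension
  has an edge outside \<open>K\<close> meeting an edge \<open>m\<close> of \<open>M\<close>, then \<open>m\<close> meets at most one edge of \<open>K\<close> and
  can be swapped in.\<close>

lemma nkd_graph_Suc:
  assumes G: "nkd_graph n (Suc k) d G"
  shows "nkd_graph n k d G"
proof -
  note fG = nkd_graphD(1)[OF G]
  have ext: "\<exists>F. M \<subseteq> F \<and> defect_matching d (delete_verts G S) F"
    if S: "S \<subseteq> verts G" "card S = n" and M: "k_matching k (delete_verts G S) M" for S M
  proof -
    let ?H = "delete_verts G S"
    have fH: "finite_simple_graph ?H" using finite_simple_delete[OF fG] .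
    have exK: "\<exists>K. k_matching (Suc k) ?H K"
      and extK: "\<And>K. k_matching (Suc k) ?H K \<Longrightarrow> \<exists>F. K \<subseteq> F \<and> defect_matching d ?H F"
      using nkd_graph_delete[OF G S] by auto
    have finM: "finite M" "card M = k" "matching ?H M" using M unfolding k_matching_def by auto
    have "\<forall>K. k_matching (Suc k) ?H K \<longrightarrow> card (K \<inter> M) < Suc k"
      using finM card_mono[of M] by (metis Int_lower2 le_imp_less_Suc)
    then obtain K where K: "k_matching (Suc k) ?H K"
      and Kmax: "\<And>K'. k_matching (Suc k) ?H K' \<Longrightarrow> card (K' \<inter> M) \<le> card (K \<inter> M)"
      using exK ex_has_greatest_nat[of "k_matching (Suc k) ?H" _ "\<lambda>K. card (K \<inter> M)"] by metis
    obtain F where F: "K \<subseteq> F" "defect_matching d ?H F" using extK[OF K] by blast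
    have mF: "matching ?H F" and cF: "card (\<Union>F) + d = card (verts ?H)"
      using F(2) unfolding defect_matching_def by auto
    have finK: "finite K" "card K = Suc k" "matching ?H K" using K unfolding k_matching_def by auto
    have "n \<le> card (verts G)" using nkd_graphD(2)[OF G] by simp
    moreover have "finite S" using S fG unfolding finite_simple_graph_def by (auto intro: finite_subset)
    ultimately have "card (verts ?H) = card (verts G) - n"
      unfolding delete_verts_def using S by (simp add: card_Diff_subset)
    \<comment> \<open>The lower bound on \<open>card (verts G)\<close> leaves room for at least one
      edge beyond the \<open>Suc k\<close> edges of \<open>K\<close>.\<close>
    then have "card K < card F"
      using nkd_graphD(2)[OF G] cF card_Union_matching[OF fH mF] finK by simp
    then have "\<not> F \<subseteq> K" using card_mono[OF finK(1)] leD by blast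
    then obtain f where f: "f \<in> F" "f \<notin> K" by blast
    show ?thesis
    proof (cases "f \<inter> \<Union>M = {}")
      case True
      have "f \<in> edges ?H" using f mF unfolding matching_def by blast
      then have "k_matching (Suc k) ?H (insert f M)"
        using k_matching_insert[OF M _ True] finite_edge(4)[OF fH] by blast
      then show ?thesis using extK by blast
    next
      case False
      then obtain x m where x: "x \<in> f" "x \<in> m" "m \<in> M" by blast
      have xK: "x \<notin> \<Union>K" using matching_unique[OF mF f(1) _ x(1)] f F(1) by blast
      then have mK: "m \<notin> K" using x by blast
      have mH: "m \<in> edges ?H" using x finM(3) unfolding matching_def by blast
      obtain y where y: "m = {x, y}" using edge_other_end[OF fH mH x(2)] by metis
      \<comment> \<open>The edge \<open>g\<close> to be swapped for \<open>m\<close> is the edge of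
        \<open>K\<close> at \<open>y\<close> if there is one. Otherwise any edge of
        \<open>K - M\<close> will do, and one exists because \<open>K\<close> is larger than
        \<open>M\<close>.\<close>
      have "\<exists>g\<in>K - M. \<forall>g'\<in>K. y \<in> g' \<longrightarrow> g' = g"
      proof (cases "y \<in> \<Union>K")
        case True
        then obtain g where g: "g \<in> K" "y \<in> g" by blast
        have "g \<notin> M" using matching_unique[OF finM(3) x(3), of g y] y g mK by blast
        then show ?thesis using g matching_unique[OF finK(3) g(1) _ g(2)] by blast
      next
        case False
        have "\<not> K \<subseteq> M" using finM finK card_mono[of M K] by auto
        then show ?thesis using False by blast
      qed
      then obtain g where g: "g \<in> K" "g \<notin> M" "\<And>g'. g' \<in> K \<Longrightarrow> y \<in> g' \<Longrightarrow> g' = g" by blast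
      define K' where "K' = insert m (K - {g})"
      have "m \<inter> \<Union>(K - {g}) = {}" using xK y g(3) by blast
      then have "matching ?H K'"
        unfolding K'_def by (rule matching_insert[OF matching_subset[OF finK(3) Diff_subset] mH])
      moreover have "card K' = Suc k" unfolding K'_def using mK finK card_Suc_Diff1[OF finK(1) g(1)]
        by (simp del: card_Diff_insert)
      ultimately have "k_matching (Suc k) ?H K'" unfolding k_matching_def K'_def using finK by simp
      then have "card (K' \<inter> M) \<le> card (K \<inter> M)" by (rule Kmax)
      \<comment> \<open>The swap gains \<open>m\<close> and loses no edge of \<open>M\<close>,
        contradicting the choice of \<open>K\<close>.\<close>
      moreover have "K' \<inter> M = insert m (K \<inter> M)" unfolding K'_def using x g by blast
      ultimately show ?thesis using mK finM by simp
    qed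
  qed
  have "\<exists>M. k_matching k (delete_verts G S) M" if S: "S \<subseteq> verts G" "card S = n" for S
  proof -
    obtain K where K: "k_matching (Suc k) (delete_verts G S) K"
      using nkd_graph_delete(1)[OF G S] by auto
    then obtain K' where "K' \<subseteq> K" "card K' = k" "finite K'"
      unfolding k_matching_def by (metis obtain_subset_with_card_n le_SucI order_refl)
    then show ?thesis using K matching_subset unfolding k_matching_def by blast
  qed
  then show ?thesis using G ext unfolding nkd_graph_def by simp_all
qed

lemma nkd_graph_odd_bound:
  assumes G: "nkd_graph n k d G" and M: "k_matching k G M"
    and Z: "Z \<subseteq> verts G" "Z \<inter> \<Union>M = {}" "n \<le> card Z"
    and C: "odd_family G (\<Union>M \<union> Z) C"
  shows "card C + n \<le> card Z + d"
proof -
  note fG = nkd_graphD(1)[OF G]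
  have mM: "matching G M" using M unfolding k_matching_def by blast
  have finV: "finite (verts G)" using fG unfolding finite_simple_graph_def by blast
  obtain S where S: "S \<subseteq> Z" "card S = n" "finite S" using obtain_subset_with_card_n[OF Z(3)] .
  obtain F where F: "M \<subseteq> F" "matching G F" "\<Union>F \<inter> S = {}"
    "card (\<Union>F) + d + n = card (verts G)"
    using nkd_graph_extend[OF G _ S(2) M] S(1) Z by blast
  let ?H = "delete_verts G (S \<union> \<Union>M)"
  have disj: "\<Union>(F - M) \<inter> \<Union>M = {}" using F(1) matching_unique[OF F(2)] by blast
  have m: "matching ?H (F - M)"
    unfolding matching_delete_iff using matching_subset[OF F(2)] F(3) disj by blast
  have vH: "verts ?H = verts G - (S \<union> \<Union>M)" unfolding delete_verts_def by simp
  have C': "odd_family ?H (Z - S) C"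
  proof (rule odd_familyI)
    fix D assume D: "D \<in> C"
    show "D \<subseteq> verts ?H" "D \<inter> (Z - S) = {}" "odd (card D)"
      using odd_familyD(1-3)[OF C D] vH S(1) by auto
    fix e x assume e: "e \<in> edges ?H" "e \<inter> (Z - S) = {}" "x \<in> e" "x \<in> D"
    then have "e \<in> edges G" "e \<inter> (\<Union>M \<union> Z) = {}" unfolding delete_verts_def by auto
    then show "e \<subseteq> D" using odd_familyD(5)[OF C D _ _ e(3,4)] by blast
  next
    show "D = D'" if "D \<in> C" "D' \<in> C" "x \<in> D" "x \<in> D'" for D D' x
      using odd_family_disjoint[OF C that] .
  qed
  have b: "card C + card (\<Union>(F - M)) \<le> card (Z - S) + card (verts ?H)"
    using odd_family_bound[OF finite_simple_delete[OF fG] m _ C'] Z vH by blast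
  have "card (\<Union>F) = card (\<Union>(F - M)) + card (\<Union>M)"
  proof -
    have "\<Union>F = \<Union>(F - M) \<union> \<Union>M" using F(1) by blast
    then show ?thesis using disj card_Un_disjoint[of "\<Union>(F - M)" "\<Union>M"]
      matching_verts(2)[OF fG F(2)] by simp
  qed
  moreover have "card (Z - S) + n = card Z"
    using S Z finV by (metis card_Diff_subset card_mono le_add_diff_inverse2 finite_subset)
  moreover have "card (verts ?H) + (n + card (\<Union>M)) = card (verts G)"
  proof -
    have "card (S \<union> \<Union>M) = n + card (\<Union>M)" using S Z matching_verts(2)[OF fG mM]
      by (subst card_Un_disjoint) auto
    moreover have "S \<union> \<Union>M \<subseteq> verts G" using S Z matching_verts(1)[OF fG mM] by blast
    ultimately show ?thesis unfolding vH using finV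
      by (metis card_Diff_subset card_mono le_add_diff_inverse2 finite_subset)
  qed
  ultimately show ?thesis using b F(4) by linarith
qed

section \<open>Modifying odd families\<close>

text \<open>Deleting one vertex of the even remainder makes the remainder odd, so it becomes a new
  part.\<close>

lemma odd_family_insert_rest:
  assumes G: "finite_simple_graph G" and C: "odd_family G T C"
    and R: "R = verts G - T - \<Union>C" "even (card R)" "v \<in> R"
  shows "odd_family G (insert v T) (insert (R - {v}) C)"
    and "card (insert (R - {v}) C) = Suc (card C)"
proof -
  have "finite R" using G R(1) unfolding finite_simple_graph_def by auto
  then have odd: "odd (card (R - {v}))" using R(2) card_Suc_Diff1[OF _ R(3)] by (metis even_Suc)
  have disj: "x \<notin> R" if "x \<in> D" "D \<in> C" for x D using that R(1) by blast
  have "R - {v} \<notin> C"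
  proof
    assume in_C: "R - {v} \<in> C"
    then obtain x where x: "x \<in> R - {v}" using odd_familyD(4)[OF C in_C] by auto
    then show False using disj[OF x in_C] by simp
  qed
  then show "card (insert (R - {v}) C) = Suc (card C)"
    using finite_odd_family[OF G C] by simp
  have edge: "e \<subseteq> R" if e: "e \<in> edges G" "e \<inter> T = {}" "x \<in> e" "x \<in> R" for e x
  proof
    fix y assume y: "y \<in> e"
    have "y \<notin> \<Union>C"
    proof
      assume "y \<in> \<Union>C"
      then obtain D where D: "D \<in> C" "y \<in> D" by blast
      have "x \<in> D" using odd_familyD(5)[OF C D(1) e(1,2) y D(2)] e(3) by blast
      then show False using disj[OF _ D(1)] e(4) by blast
    qed
    then show "y \<in> R" using y e(2) finite_edge(2)[OF G e(1)] R(1) by blast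
  qed
  show "odd_family G (insert v T) (insert (R - {v}) C)"
  proof (rule odd_familyI)
    fix D assume D: "D \<in> insert (R - {v}) C"
    show "D \<subseteq> verts G" using D odd_familyD(1)[OF C] R(1) by blast
    show "D \<inter> insert v T = {}" using D odd_familyD(2)[OF C] R(1,3) by blast
    show "odd (card D)" using D odd odd_familyD(3)[OF C] by blast
    show "e \<subseteq> D" if "e \<in> edges G" "e \<inter> insert v T = {}" "x \<in> e" "x \<in> D" for e x
    proof (cases "D = R - {v}")
      case True
      then show ?thesis using edge[OF that(1) _ that(3)] that(2,4) by blast
    next
      case False
      then show ?thesis using odd_familyD(5)[OF C _ that(1) _ that(3,4)] D that(2) by blast
    qed
  next
    fix D D' x assume "D \<in> insert (R - {v}) C" "D' \<in> insert (R - {v}) C" "x \<in> D" "x \<in> D'"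
    then show "D = D'" using odd_family_disjoint[OF C, of D D' x] disj by blast
  qed
qed

text \<open>An odd part that loses two vertices stays odd, hence nonempty and distinct from the
  other parts. Two more vertices are deleted at no cost in the number of parts.\<close>

lemma odd_family_remove_pair:
  assumes G: "finite_simple_graph G" and C: "odd_family G T C"
    and D: "D \<in> C" "a \<in> D" "b \<in> D" "a \<noteq> b"
  shows "odd_family G (insert a (insert b T)) (insert (D - {a, b}) (C - {D}))"
    and "card (insert (D - {a, b}) (C - {D})) = card C"
proof -
  have "finite D" using odd_familyD(1)[OF C D(1)] G finite_subset
    unfolding finite_simple_graph_def by blast
  then have "card D = card (D - {a, b}) + 2"
    using D card_Diff_subset[of "{a, b}" D] card_mono[of D "{a, b}"] by simp
  then have odd: "odd (card (D - {a, b}))" using odd_familyD(3)[OF C D(1)] by simp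
  have disj: "D' = D" if "x \<in> D'" "D' \<in> C" "x \<in> D" for x D'
    using odd_family_disjoint[OF C that(2) D(1) that(1,3)] .
  have "D - {a, b} \<noteq> {}" using odd by (metis card.empty even_zero)
  then obtain x where x: "x \<in> D - {a, b}" by auto
  have "D - {a, b} \<notin> C - {D}"
  proof
    assume in_C: "D - {a, b} \<in> C - {D}"
    then have "D - {a, b} = D" using disj[OF x] x by auto
    then show False using in_C by auto
  qed
  then show "card (insert (D - {a, b}) (C - {D})) = card C"
    using finite_odd_family[OF G C] card_Suc_Diff1[OF _ D(1)] by simp
  show "odd_family G (insert a (insert b T)) (insert (D - {a, b}) (C - {D}))"
  proof (rule odd_familyI)
    fix D' assume D': "D' \<in> insert (D - {a, b}) (C - {D})"
    show "D' \<subseteq> verts G" using D' odd_familyD(1)[OF C] D(1) by blast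
    show "D' \<inter> insert a (insert b T) = {}" using D' odd_familyD(2)[OF C] D disj by blast
    show "odd (card D')" using D' odd odd_familyD(3)[OF C] by blast
    fix e x assume e: "e \<in> edges G" "e \<inter> insert a (insert b T) = {}" "x \<in> e" "x \<in> D'"
    show "e \<subseteq> D'"
    proof (cases "D' = D - {a, b}")
      case True
      then show ?thesis using odd_familyD(5)[OF C D(1) e(1) _ e(3)] e(2,4) by blast
    next
      case False
      then show ?thesis using odd_familyD(5)[OF C _ e(1) _ e(3,4)] D' e(2) by blast
    qed
  next
    fix D1 D2 x assume "D1 \<in> insert (D - {a, b}) (C - {D})" "D2 \<in> insert (D - {a, b}) (C - {D})"
      "x \<in> D1" "x \<in> D2"
    then show "D1 = D2" using odd_family_disjoint[OF C, of D1 D2 x] disj by blast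
  qed
qed

text \<open>Deleting the star centres isolates the rest of \<open>W\<close> and keeps exactly those \<open>D \<in> C\<close> whose
  centre lies in \<open>W\<close>; together these sets form \<open>C'\<close>.\<close>

lemma odd_family_star_centres:
  assumes G: "finite_simple_graph G" and C: "odd_family G (X \<union> W) C"
    and W: "W \<subseteq> verts G" "W \<inter> X = {}"
    and out: "\<And>w y. w \<in> W \<Longrightarrow> {w, y} \<in> edges G \<Longrightarrow> y \<in> X \<union> \<Union>C"
    and z: "\<And>D. D \<in> C \<Longrightarrow> z D \<in> W \<union> D"
      "\<And>D w v. D \<in> C \<Longrightarrow> w \<in> W \<Longrightarrow> v \<in> D \<Longrightarrow> {w, v} \<in> edges G \<Longrightarrow> z D \<in> {w, v}"
    and Z: "z ` C \<subseteq> Z" "Z \<subseteq> z ` C \<union> W"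
  obtains C' where "odd_family G (X \<union> Z) C'" "card C' + card Z = card C + card W"
proof -
  define C1 where "C1 = {D \<in> C. z D \<in> W}"
  define C' where "C' = C1 \<union> (\<lambda>w. {w}) ` (W - Z)"
  have finC: "finite C" using finite_odd_family[OF G C] .
  have finW: "finite W" using W(1) G unfolding finite_simple_graph_def by (auto intro: finite_subset)
  have finZ: "finite Z" using Z(2) finC finW finite_subset by blast
  have CW: "x \<notin> W" "x \<notin> X" if "x \<in> D" "D \<in> C" for x D
    using odd_familyD(2)[OF C that(2)] that(1) by blast+
  have C1Z: "D \<inter> Z = {}" if D: "D \<in> C1" for D
  proof (rule ccontr)
    assume "D \<inter> Z \<noteq> {}"
    then obtain x where x: "x \<in> D" "x \<in> Z" by blast
    have DC: "D \<in> C" "z D \<in> W" using D unfolding C1_def by auto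
    have "x \<notin> W" using CW(1)[OF x(1) DC(1)] .
    then obtain D' where D': "D' \<in> C" "x = z D'" using x(2) Z(2) by blast
    then have "x \<in> D'" using z(1)[OF D'(1)] \<open>x \<notin> W\<close> by simp
    then have "D' = D" using odd_family_disjoint[OF C D'(1) DC(1) _ x(1)] by simp
    then show False using DC(2) D'(2) \<open>x \<notin> W\<close> by simp
  qed
  have fam: "odd_family G (X \<union> Z) C'"
  proof (rule odd_familyI)
    fix D assume "D \<in> C'"
    then consider (1) "D \<in> C1" "D \<in> C" | (2) w where "D = {w}" "w \<in> W" "w \<notin> Z"
      unfolding C'_def C1_def by blast
    note cs = this
    show "D \<subseteq> verts G" using cs odd_familyD(1)[OF C] W(1) by cases blast+
    show "D \<inter> (X \<union> Z) = {}" using cs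
    proof cases
      case 1
      then show ?thesis using C1Z CW(2) by blast
    next
      case 2
      then show ?thesis using W(2) by blast
    qed
    show "odd (card D)" using cs odd_familyD(3)[OF C] by cases auto
    fix e x assume e: "e \<in> edges G" "e \<inter> (X \<union> Z) = {}" "x \<in> e" "x \<in> D"
    obtain y where y: "e = {x, y}" "x \<noteq> y" using edge_other_end[OF G e(1,3)] by metis
    \<comment> \<open>An edge from \<open>W\<close> to a part contains the centre of that part,
      which lies in \<open>Z\<close>.\<close>
    have meet: False if "D' \<in> C" "w \<in> W" "v \<in> D'" "e = {w, v}" for D' w v
      using z(2)[OF that(1-3)] that(1,4) e(1,2) Z(1) by blast
    show "e \<subseteq> D" using cs
    proof cases
      case 1
      have "y \<notin> W" using meet[OF 1(2) _ e(4)] y(1) by (metis insert_commute)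
      then have "e \<inter> (X \<union> W) = {}" using e(2) y(1) CW(1)[OF e(4) 1(2)] by blast
      then show ?thesis using odd_familyD(5)[OF C 1(2) e(1) _ e(3,4)] by blast
    next
      case 2
      then have xW: "x \<in> W" using e(4) by blast
      have "y \<in> X \<union> \<Union>C" using out[OF xW] e(1) y(1) by blast
      then have "\<exists>D'\<in>C. y \<in> D'" using e(2) y(1) by blast
      then show ?thesis using meet[OF _ xW _ y(1)] by blast
    qed
  next
    fix D D' x assume "D \<in> C'" "D' \<in> C'" "x \<in> D" "x \<in> D'"
    then show "D = D'" using odd_family_disjoint[OF C, of D D' x] CW(1)[of x]
      unfolding C'_def C1_def by blast
  qed
  have "C1 \<inter> (\<lambda>w. {w}) ` (W - Z) = {}" using CW(1) unfolding C1_def by blast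
  then have "card C' = card C1 + card (W - Z)"
    unfolding C'_def using finC finW
    by (subst card_Un_disjoint) (auto simp: C1_def card_image)
  moreover have "card Z = card (Z \<inter> W) + card (Z - W)"
    using finZ by (metis card_Int_Diff)
  moreover have "card W = card (Z \<inter> W) + card (W - Z)"
    using finW by (metis card_Int_Diff inf_commute)
  \<comment> \<open>The members of \<open>Z\<close> outside \<open>W\<close> are the centres of the
    lost parts. Each lies in its own part, so they are distinct.\<close>
  moreover have "card (Z - W) = card (C - C1)"
  proof -
    have "Z - W = z ` (C - C1)" using Z unfolding C1_def by blast
    moreover have "inj_on z (C - C1)"
    proof (rule inj_onI)
      fix D D' assume D: "D \<in> C - C1" "D' \<in> C - C1" "z D = z D'"
      then have "z D \<in> D" "z D' \<in> D'" using z(1) unfolding C1_def by blast+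
      then show "D = D'" using odd_family_disjoint[OF C, of D D' "z D"] D by auto
    qed
    ultimately show ?thesis by (simp add: card_image)
  qed
  moreover have "card C = card C1 + card (C - C1)"
    using finC card_Int_Diff[of C C1] unfolding C1_def by (simp add: Int_def)
  ultimately show ?thesis using that[OF fam] by linarith
qed

lemma even_card_Union_odd_family:
  assumes "finite_simple_graph G" "odd_family G T C"
  shows "even (card (\<Union>C)) \<longleftrightarrow> even (card C)"
proof -
  have "finite D" if "D \<in> C" for D
    using odd_familyD(1)[OF assms(2) that] assms(1) finite_subset
    unfolding finite_simple_graph_def by metis
  then have "card (\<Union>C) = sum card C"
    using assms(2) unfolding odd_family_def by (intro card_Union_disjoint) auto
  moreover have "{D \<in> C. odd (card D)} = C" using odd_familyD(3)[OF assms(2)] by auto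
  ultimately show ?thesis
    using even_sum_iff[OF finite_odd_family[OF assms], of card] by simp
qed

section \<open>Excluding a large odd family\<close>

text \<open>Here \<open>t\<close> is the size of the set T and \<open>W\<close> is the union of S
  and T. For \<open>M\<close> and \<open>W\<close> themselves \<open>nkd_graph_odd_bound\<close>
  holds with equality, so every modification that shifts the balance is impossible.\<close>

lemma nkd_graph_no_large_odd_family:
  assumes G: "nkd_graph n (k + 2) d G" and nd: "d < n"
    and M: "k_matching k G M" and W: "W \<subseteq> verts G" "W \<inter> \<Union>M = {}"
    and C: "odd_family G (\<Union>M \<union> W) C"
    and cW: "card W = t + n + 2" and cC: "card C = t + d + 2"
  shows False
proof -
  have G1: "nkd_graph n (Suc k) d G" using nkd_graph_Suc[of n "Suc k" d G] G by simp
  have G0: "nkd_graph n k d G" using nkd_graph_Suc[OF G1] .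
  note fG = nkd_graphD(1)[OF G]
  have finV: "finite (verts G)" using fG unfolding finite_simple_graph_def by blast
  have finW: "finite W" using finite_subset[OF W(1) finV] .
  let ?X = "\<Union>M"
  have mM: "matching G M" and cM: "card M = k" using M unfolding k_matching_def by auto
  note X = matching_verts[OF fG mM]
  define R where "R = verts G - (?X \<union> W) - \<Union>C"
  have CV: "\<Union>C \<subseteq> verts G" using odd_familyD(1)[OF C] by blast
  have CX: "\<Union>C \<inter> (?X \<union> W) = {}" using odd_familyD(2)[OF C] by blast
  \<comment> \<open>Modulo 2, \<open>verts G\<close> has n + d vertices, \<open>W\<close> has t + n,
    the parts together have t + d, and \<open>M\<close> covers an even number.\<close>
  have evR: "even (card R)"
  proof -
    have "card (?X \<union> W) = card ?X + card W"
      using W(2) X(2) finW by (intro card_Un_disjoint) auto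
    moreover have "card ((?X \<union> W) \<union> \<Union>C) = card (?X \<union> W) + card (\<Union>C)"
      using CX X(2) finW finite_subset[OF CV finV] by (intro card_Un_disjoint) auto
    moreover have "card (((?X \<union> W) \<union> \<Union>C) \<union> R) = card ((?X \<union> W) \<union> \<Union>C) + card R"
      using X(2) finW finite_subset[OF CV finV] finV unfolding R_def
      by (intro card_Un_disjoint) auto
    moreover have "((?X \<union> W) \<union> \<Union>C) \<union> R = verts G" unfolding R_def using X(1) W(1) CV by blast
    ultimately have "card (verts G) = 2 * k + (t + n + 2) + card (\<Union>C) + card R"
      using card_Union_matching[OF fG mM] cM cW by simp
    moreover have "even (card (\<Union>C)) \<longleftrightarrow> even (t + d)"
      using even_card_Union_odd_family[OF fG C] cC by simp
    moreover have "even (card (verts G)) \<longleftrightarrow> even (n + d)"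
      using nkd_graphD(3)[OF G] by auto
    ultimately show ?thesis by auto
  qed
  \<comment> \<open>Moving \<open>e\<close> into the matching takes two vertices from
    \<open>W\<close> and keeps all t + d + 2 parts, while the bound drops to t + d.\<close>
  have indep: False if e: "e \<in> edges G" "e \<subseteq> W" for e
  proof -
    have M1: "k_matching (Suc k) G (insert e M)"
      using k_matching_insert[OF M e(1)] e(2) W(2) finite_edge(4)[OF fG e(1)] by blast
    have "card (W - e) = t + n"
      using card_Diff_subset[OF finite_edge(1)[OF fG e(1)] e(2)] finite_edge(3)[OF fG e(1)] cW
      by simp
    moreover have "\<Union>(insert e M) \<union> (W - e) = ?X \<union> W" using e(2) by auto
    moreover have "(W - e) \<inter> \<Union>(insert e M) = {}" using W(2) by auto
    ultimately show False
      using nkd_graph_odd_bound[OF G1 M1, of "W - e" C] W(1) C cC by auto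
  qed
  \<comment> \<open>\<open>W\<close> loses one vertex and the family gains a part: t + d + 3 parts
    against a bound of t + d + 1.\<close>
  have noR: False if w: "w \<in> W" and v: "v \<in> R" and e: "{w, v} \<in> edges G" for w v
  proof -
    have vn: "v \<notin> ?X" "v \<notin> W" using v unfolding R_def by auto
    have M1: "k_matching (Suc k) G (insert {w, v} M)"
      using k_matching_insert[OF M e] w W(2) vn by blast
    have "card (W - {w}) = t + n + 1" using cW w by simp
    moreover have "\<Union>(insert {w, v} M) \<union> (W - {w}) = insert v (?X \<union> W)" using w by auto
    moreover have "(W - {w}) \<inter> \<Union>(insert {w, v} M) = {}" using W(2) vn by auto
    ultimately show False
      using nkd_graph_odd_bound[OF G1 M1, of "W - {w}" "insert (R - {v}) C"] W(1)
        odd_family_insert_rest[OF fG C R_def evR v] cC by auto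
  qed
  \<comment> \<open>Two edges are added, so the property for \<open>k + 2\<close> is used.
    \<open>W\<close> loses two vertices and the number of parts is unchanged.\<close>
  have noD: False if D: "D \<in> C" "v \<in> D" "v' \<in> D" "v \<noteq> v'" and w: "w \<in> W" "w' \<in> W" "w \<noteq> w'"
    and e: "{w, v} \<in> edges G" "{w', v'} \<in> edges G" for D v v' w w'
  proof -
    have vn: "v \<notin> ?X" "v \<notin> W" "v' \<notin> ?X" "v' \<notin> W" using odd_familyD(2)[OF C D(1)] D(2,3) by auto
    have M1: "k_matching (Suc k) G (insert {w, v} M)"
      using k_matching_insert[OF M e(1)] w W(2) vn by blast
    have "{w', v'} \<inter> \<Union>(insert {w, v} M) = {}" using w W(2) vn D(4) by auto
    then have M2: "k_matching (k + 2) G (insert {w', v'} (insert {w, v} M))"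
      using k_matching_insert[OF M1 e(2)] by auto
    have "card (W - {w, w'}) = t + n"
      using card_Diff_subset[of "{w, w'}" W] w cW by simp
    moreover have "\<Union>(insert {w', v'} (insert {w, v} M)) \<union> (W - {w, w'}) = insert v (insert v' (?X \<union> W))"
      using w by auto
    moreover have "(W - {w, w'}) \<inter> \<Union>(insert {w', v'} (insert {w, v} M)) = {}"
      using W(2) vn by auto
    ultimately show False
      using nkd_graph_odd_bound[OF G M2, of "W - {w, w'}" "insert (D - {v, v'}) (C - {D})"] W(1)
        odd_family_remove_pair[OF fG C D] cC by auto
  qed
  \<comment> \<open>The edges between \<open>W\<close> and \<open>D\<close> pairwise meet. Being
    bipartite they form no triangle, so they share a vertex, the centre. Without such edges any
    vertex of \<open>D\<close> serves.\<close>
  have "\<exists>z. z \<in> W \<union> D \<and> (\<forall>w\<in>W. \<forall>v\<in>D. {w, v} \<in> edges G \<longrightarrow> z \<in> {w, v})" if D: "D \<in> C" for D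
  proof (cases "\<exists>w\<in>W. \<exists>v\<in>D. {w, v} \<in> edges G")
    case True
    then obtain w v where wv: "w \<in> W" "v \<in> D" "{w, v} \<in> edges G" by blast
    show ?thesis
    proof (rule ccontr)
      assume no: "\<not> ?thesis"
      have "\<exists>w1\<in>W. \<exists>v1\<in>D. {w1, v1} \<in> edges G \<and> z \<noteq> w1 \<and> z \<noteq> v1" if "z \<in> W \<union> D" for z
        using no that by auto
      then obtain w1 v1 w2 v2 where
        1: "w1 \<in> W" "v1 \<in> D" "{w1, v1} \<in> edges G" "w \<noteq> w1" and
        2: "w2 \<in> W" "v2 \<in> D" "{w2, v2} \<in> edges G" "v \<noteq> v2"
        using wv(1,2) by (metis UnCI)
      \<comment> \<open>An edge avoiding \<open>w\<close> must pass through \<open>v\<close>, and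
        one avoiding \<open>v\<close> through \<open>w\<close>. These two edges are then
        disjoint.\<close>
      have "v1 = v" using noD[OF D wv(2) 1(2) _ wv(1) 1(1,4) wv(3) 1(3)] by auto
      moreover have "w2 = w" using noD[OF D wv(2) 2(2,4) wv(1) 2(1) _ wv(3) 2(3)] by auto
      ultimately show False using noD[OF D 1(2) 2(2) _ 1(1) 2(1) _ 1(3) 2(3)] 1(4) 2(4) by auto
    qed
  next
    case False
    then show ?thesis using odd_familyD(4)[OF C D] by auto
  qed
  then obtain z where z: "\<And>D. D \<in> C \<Longrightarrow> z D \<in> W \<union> D"
    "\<And>D w v. D \<in> C \<Longrightarrow> w \<in> W \<Longrightarrow> v \<in> D \<Longrightarrow> {w, v} \<in> edges G \<Longrightarrow> z D \<in> {w, v}" by metis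
  have finC: "finite C" using finite_odd_family[OF fG C] .
  have cz: "card (z ` C) \<le> t + d + 2" using card_image_le[OF finC, of z] cC by simp
  have "card W \<le> card (z ` C \<union> W)" "card (z ` C) \<le> card (z ` C \<union> W)"
    using finC finW by (intro card_mono; auto)+
  \<comment> \<open>The centres are padded with vertices of \<open>W\<close>, because the bound
    requires at least \<open>n\<close> deleted vertices.\<close>
  then obtain Z where Z: "z ` C \<subseteq> Z" "Z \<subseteq> z ` C \<union> W" "card Z = max n (card (z ` C))"
    using exists_subset_between[of "z ` C" "max n (card (z ` C))" "z ` C \<union> W"] finC finW cW
    by auto
  have out: "y \<in> ?X \<union> \<Union>C" if "w \<in> W" "{w, y} \<in> edges G" for w y
  proof -
    have "y \<in> verts G" using finite_edge(2)[OF fG that(2)] by auto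
    moreover have "y \<notin> W" using indep[OF that(2)] that(1) by auto
    moreover have "y \<notin> R" using noR[OF that(1) _ that(2)] by auto
    ultimately show ?thesis unfolding R_def by auto
  qed
  obtain C' where C': "odd_family G (?X \<union> Z) C'" "card C' + card Z = card C + card W"
    by (rule odd_family_star_centres[OF fG C W _ _ _ Z(1,2)]) (use out z in auto)
  have "Z \<subseteq> verts G" "Z \<inter> ?X = {}"
  proof -
    have "z ` C \<subseteq> W \<union> \<Union>C" using z(1) by auto
    then have "Z \<subseteq> W \<union> \<Union>C" using Z(2) by blast
    then show "Z \<subseteq> verts G" "Z \<inter> ?X = {}" using W CV CX by blast+
  qed
  then have "card C' + n \<le> card Z + d"
    using nkd_graph_odd_bound[OF G0 M _ _ _ C'(1)] Z(3) by simp
  \<comment> \<open>Eliminating \<open>card C'\<close> gives \<open>card Z\<close> \<ge> t + n + 2.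
    But \<open>card Z\<close> is at most the maximum of n and t + d + 2, which is smaller since
    \<open>d < n\<close>.\<close>
  then show False using C'(2) cC cW Z(3) cz nd by linarith
qed

section \<open>Passing from n to n + 2\<close>

lemma nkd_graph_extend_deleted:
  assumes G: "nkd_graph n (k + 2) d G" and nd: "d < n"
    and S: "S \<subseteq> verts G" "card S = n + 2"
    and M: "k_matching k (delete_verts G S) M"
  shows "\<exists>F. M \<subseteq> F \<and> defect_matching d (delete_verts G S) F"
proof -
  note fG = nkd_graphD(1)[OF G]
  have finV: "finite (verts G)" using fG unfolding finite_simple_graph_def by blast
  have finS: "finite S" using finite_subset[OF S(1) finV] .
  have MG: "k_matching k G M" and MS: "\<Union>M \<inter> S = {}"
    using M unfolding k_matching_delete_iff by auto
  have mM: "matching G M" and cM: "card M = k" using MG unfolding k_matching_def by auto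
  note X = matching_verts[OF fG mM]
  let ?X = "\<Union>M"
  let ?H = "delete_verts G (S \<union> ?X)"
  have fH: "finite_simple_graph ?H" using finite_simple_delete[OF fG] .
  have vH: "verts ?H = verts G - (S \<union> ?X)" unfolding delete_verts_def by simp
  have cX: "card ?X = 2 * k" using card_Union_matching[OF fG mM] cM by simp
  have "card (S \<union> ?X) = n + 2 + 2 * k"
    using cX S(2) MS X(2) finS by (subst card_Un_disjoint) auto
  moreover have "S \<union> ?X \<subseteq> verts G" using S X by auto
  ultimately have cH: "card (verts ?H) + (n + 2 + 2 * k) = card (verts G)"
    unfolding vH using finV
    by (metis card_Diff_subset card_mono finite_subset le_add_diff_inverse2)
  have "d \<le> card (verts ?H)" using cH nkd_graphD(2)[OF G] by simp
  moreover have "even (card (verts ?H) + d)"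
    using nkd_graphD(3)[OF G] cH[symmetric] by simp
  \<comment> \<open>\<open>q\<close> is the number of edges still needed for defect exactly
    \<open>d\<close>.\<close>
  ultimately obtain q where q: "card (verts ?H) = d + 2 * q"
    by (metis add.commute dvdE even_diff_nat le_add_diff_inverse linorder_not_less)
  obtain F0 T C0 where B: "matching ?H F0" "T \<subseteq> verts ?H" "odd_family ?H T C0"
    "card T + card (verts ?H) \<le> card (\<Union>F0) + card C0"
    using berge_tutte[OF fH] by metis
  have cF0: "card (\<Union>F0) = 2 * card F0" using card_Union_matching[OF fH B(1)] .
  have "q \<le> card F0"
  proof (rule ccontr)
    assume "\<not> ?thesis"
    \<comment> \<open>A matching short of \<open>q\<close> edges misses at least d + 2 vertices,
      because a deficit of one edge counts twice.\<close>
    then have "card T + d + 2 \<le> card C0" using B(4) cF0 q by linarith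
    then obtain C where C: "C \<subseteq> C0" "card C = card T + d + 2"
      by (metis obtain_subset_with_card_n)
    have famH: "odd_family ?H T C" using odd_family_subset[OF B(3) C(1)] .
    have "odd_family G (?X \<union> (S \<union> T)) C"
    proof (rule odd_familyI)
      fix D assume D: "D \<in> C"
      show "D \<subseteq> verts G" "D \<inter> (?X \<union> (S \<union> T)) = {}" "odd (card D)"
        using odd_familyD(1-3)[OF famH D] vH by auto
      fix e x assume e: "e \<in> edges G" "e \<inter> (?X \<union> (S \<union> T)) = {}" "x \<in> e" "x \<in> D"
      then have "e \<in> edges ?H" "e \<inter> T = {}" unfolding delete_verts_def by auto
      then show "e \<subseteq> D" using odd_familyD(5)[OF famH D _ _ e(3,4)] by simp
    next
      show "D = D'" if "D \<in> C" "D' \<in> C" "x \<in> D" "x \<in> D'" for D D' x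
        using odd_family_disjoint[OF famH that] .
    qed
    moreover have "S \<union> T \<subseteq> verts G" "(S \<union> T) \<inter> ?X = {}" using S(1) B(2) vH MS by auto
    moreover have "card (S \<union> T) = card T + n + 2"
    proof -
      have "finite T" "S \<inter> T = {}" using B(2) vH finV by (auto intro: finite_subset)
      then show ?thesis using card_Un_disjoint[OF finS] S(2) by simp
    qed
    ultimately show False using nkd_graph_no_large_odd_family[OF G nd MG] C(2) by metis
  qed
  \<comment> \<open>\<open>F0\<close> may be too large; trimming it to \<open>q\<close> edges makes
    the defect exactly \<open>d\<close>.\<close>
  then obtain F1 where F1: "F1 \<subseteq> F0" "card F1 = q" by (metis obtain_subset_with_card_n)
  have m1: "matching ?H F1" using matching_subset[OF B(1) F1(1)] .
  then have m1G: "matching G F1" and d1: "\<Union>F1 \<inter> S = {}" "\<Union>F1 \<inter> ?X = {}"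
    unfolding matching_delete_iff by auto
  have "pairwise disjnt (M \<union> F1)"
  proof (rule pairwiseI)
    fix e f assume "e \<in> M \<union> F1" "f \<in> M \<union> F1" "e \<noteq> f"
    then show "disjnt e f"
      using matching_unique[OF mM, of e f] matching_unique[OF m1G, of e f] d1(2)
      unfolding disjnt_def by blast
  qed
  then have "matching (delete_verts G S) (M \<union> F1)"
    unfolding matching_delete_iff using mM m1G MS d1(1) unfolding matching_def by auto
  moreover have "card (\<Union>(M \<union> F1)) + d = card (verts (delete_verts G S))"
  proof -
    have "card (\<Union>(M \<union> F1)) = card ?X + card (\<Union>F1)"
      using card_Un_disjoint[OF X(2) matching_verts(2)[OF fG m1G]] d1(2)
      by (simp add: Int_commute)
    moreover have "card (verts (delete_verts G S)) = card (verts G) - (n + 2)"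
      unfolding delete_verts_def using S finS by (simp add: card_Diff_subset)
    ultimately show ?thesis using card_Union_matching[OF fG m1G] F1(2) cX cH q by simp
  qed
  ultimately show ?thesis unfolding defect_matching_def by blast
qed

text \<open>Each vertex of \<open>Y\<close> lies on at most one edge of \<open>K\<close>, so
  avoiding \<open>Y\<close> costs at most \<open>card Y\<close> edges.\<close>

lemma k_matching_avoiding:
  assumes "k_matching (k + card Y) G K" "finite Y"
  obtains M where "k_matching k G M" "\<Union>M \<inter> Y = {}"
proof -
  let ?B = "{e \<in> K. e \<inter> Y \<noteq> {}}"
  have K: "matching G K" "finite K" "card K = k + card Y" using assms(1) unfolding k_matching_def by auto
  have "\<exists>y. y \<in> e \<inter> Y" if "e \<in> ?B" for e using that by auto
  then obtain y where y: "\<And>e. e \<in> ?B \<Longrightarrow> y e \<in> e \<inter> Y" by metis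
  have "inj_on y ?B"
  proof (rule inj_onI)
    fix e f assume ef: "e \<in> ?B" "f \<in> ?B" "y e = y f"
    show "e = f" using matching_unique[OF K(1), of e f "y e"] ef y[OF ef(1)] y[OF ef(2)] by auto
  qed
  then have "card ?B \<le> card Y" using y assms(2) by (intro card_inj_on_le[of y]) auto
  moreover have "card (K - ?B) = card K - card ?B" using K(2) by (intro card_Diff_subset) auto
  ultimately have "k \<le> card (K - ?B)" using K(3) by simp
  then obtain M where M: "M \<subseteq> K - ?B" "card M = k" "finite M" by (rule obtain_subset_with_card_n)
  have "matching G M" using matching_subset[OF K(1)] M(1) by auto
  then show ?thesis using that[of M] M unfolding k_matching_def by auto
qed

theorem theorem2p2:
  fixes G :: "'a graph" and n k d :: nat
  assumes "n > d" and "k \<ge> 2"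
    and "nkd_graph n k d G"
  shows "nkd_graph (n + 2) (k - 2) d G"
proof -
  define j where "j = k - 2"
  have "j + 2 = k" using assms(2) unfolding j_def by simp
  then have G: "nkd_graph n (j + 2) d G" using assms(3) by simp
  have ex: "\<exists>M. k_matching j (delete_verts G S) M" if S: "S \<subseteq> verts G" "card S = n + 2" for S
  proof -
    have "finite S" using S(2) card.infinite by fastforce
    \<comment> \<open>A \<open>k\<close>-matching avoiding \<open>S0\<close> exists by hypothesis.
      The two remaining vertices of \<open>S\<close> destroy at most two of its edges.\<close>
    obtain S0 where S0: "S0 \<subseteq> S" "card S0 = n" "finite S0"
      using obtain_subset_with_card_n[of n S] S(2) by auto
    have "card (S - S0) = 2" using card_Diff_subset[OF S0(3,1)] S(2) S0(2) by simp
    moreover obtain K where "k_matching (j + 2) (delete_verts G S0) K"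
      using nkd_graph_delete(1)[OF G _ S0(2)] S0(1) S(1) by auto
    ultimately obtain M where "k_matching j (delete_verts G S0) M" "\<Union>M \<inter> (S - S0) = {}"
      using k_matching_avoiding[of j "S - S0"] \<open>finite S\<close> by (metis finite_Diff)
    then have "k_matching j (delete_verts G S) M"
      unfolding k_matching_delete_iff by auto
    then show ?thesis by blast
  qed
  have "even (int (card (verts G)) - int (n + 2) - int d)" using nkd_graphD(3)[OF G] by simp
  then have "nkd_graph (n + 2) j d G"
    unfolding nkd_graph_def
    using nkd_graphD(1,2)[OF G] ex nkd_graph_extend_deleted[OF G assms(1)] by simp
  then show ?thesis unfolding j_def .
qed

end
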